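(* Let $n\ge 1$, let $k$ be an integer with $0\le k\le n+1$, let $c\in\mathbb{R}$ with $c\neq 0$, and let $X^n=X^n_{c,k}$. Let $G=(V,E)$ be a finite graph and $p:V\to X^n$. Then the framework $G(p)$ is first-order rigid in $X^n$ if and only if the framework $G(\psi_{\mathbb{S}_+}\circ p)$ is first-order rigid in $\mathbb{S}^n_+$, where $\psi_{\mathbb{S}_+}:X^n\to\mathbb{S}^n_+$, $\psi_{\mathbb{S}_+}(x)=x/\sqrt{x\cdot x}$.
   Context: Here $x\cdot y$ is the standard inner product on $\mathbb{R}^{n+1}$. For $x,y\in\mathbb{R}^{n+1}$ put $$\langle x,y\rangle_k=x_1y_1+\cdots+x_{n-k+1}y_{n-k+1}-x_{n-k+2}y_{n-k+2}-\cdots-x_{n+1}y_{n+1},$$ and let $X^n_{c,k}=\{x\in\mathbb{R}^{n+1}:\langle x,x\rangle_k=c,\ x_{n+1}>0\}$. (Hyperbolic space $\mathbb{H}^n$ is the case $k=1,c=-1$; exterior hyperbolic space $\mathbb{D}^n$ is $k=1,c=1$; the upper hemisphere $\mathbb{S}^n_+=\{x: x\cdot x=1,\ x_{n+1}>0\}$ is $k=0,c=1$.) A graph $G=(V,E)$ has finite vertex set $V$ and an edge set $E$ of unordered pairs of distinct vertices. A bar-and-joint framework $G(p)$ in $X^n$ is a graph $G$ together with a map $p:V\to X^n$; write $p_i=p(i)$, $u_i=u(i)$. A first-order motion of $G(p)$ in $X^n$ is a map $u:V\to\mathbb{R}^{n+1}$ with $\langle p_i,u_j\rangle_k+\langle p_j,u_i\rangle_k=0$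 for all $\{i,j\}\in E$ and $\langle p_i,u_i\rangle_k=0$ for all $i\in V$. A trivial first-order motion of $X^n$ is a map $u:X^n\to\mathbb{R}^{n+1}$ with $\langle x,u(y)\rangle_k+\langle y,u(x)\rangle_k=0$ and $\langle z,u(z)\rangle_k=0$ for all $x,y,z\in X^n$. $G(p)$ is first-order rigid in $X^n$ if every first-order motion $u$ of $G(p)$ is the restriction of a trivial first-order motion $w$ of $X^n$, i.e. $u_i=w(p_i)$ for all $i\in V$. For $\mathbb{S}^n_+$ these notions are the case $k=0$, $c=1$ (so $\langle\cdot,\cdot\rangle_0$ is the standard inner product). *)

theory Defs
  imports Complex_Main "Jordan_Normal_Form.Matrix"
begin

text \<open>
  The space of real \<open>(n + 1)\<close>-tuples is \<open>carrier_vec (n + 1)\<close>, whose coordinates are numbered from 0: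
  the coordinate written \<open>x\<^sub>i\<close> in mathematical texts (\<open>1 \<le> i \<le> n + 1\<close>) is \<open>x $ (i - 1)\<close>,
  so the last one is \<open>x $ n\<close>. The standard inner product is \<open>x \<bullet> y\<close>.
\<close>

text \<open>The last \<open>k\<close> of the \<open>n + 1\<close> coordinates carry a minus sign; only used for \<open>k \<le> n + 1\<close>.\<close>

definition form :: "nat \<Rightarrow> nat \<Rightarrow> real vec \<Rightarrow> real vec \<Rightarrow> real" where
  "form n k x y = (\<Sum>i\<in>{0..<n + 1 - k}. x $ i * y $ i) - (\<Sum>i\<in>{n + 1 - k..<n + 1}. x $ i * y $ i)"

definition quadric :: "nat \<Rightarrow> nat \<Rightarrow> real \<Rightarrow> real vec set" where
  "quadric n k c = {x \<in> carrier_vec (n + 1). form n k x x = c \<and> x $ n > 0}"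

definition hemisphere :: "nat \<Rightarrow> real vec set" where
  "hemisphere n = {x \<in> carrier_vec (n + 1). x \<bullet> x = 1 \<and> x $ n > 0}"

definition finite_graph :: "'v set \<Rightarrow> 'v set set \<Rightarrow> bool" where
  "finite_graph V E \<longleftrightarrow> finite V \<and> (\<forall>e\<in>E. e \<subseteq> V \<and> card e = 2)"

text \<open>
  The ambient space enters the following notions through the form (given by \<open>n\<close> and \<open>k\<close>)
  and through the point set \<open>X\<close>. Maps defined on \<open>V\<close> or on \<open>X\<close> are total functions
  whose values outside that set are irrelevant.
\<close>

definition first_order_motion ::
  "nat \<Rightarrow> nat \<Rightarrow> 'v set \<Rightarrow> 'v set set \<Rightarrow> ('v \<Rightarrow> real vec) \<Rightarrow> ('v \<Rightarrow> real vec) \<Rightarrow> bool" where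
  "first_order_motion n k V E p u \<longleftrightarrow>
     u \<in> V \<rightarrow> carrier_vec (n + 1) \<and>
     (\<forall>i j. {i, j} \<in> E \<longrightarrow> form n k (p i) (u j) + form n k (p j) (u i) = 0) \<and>
     (\<forall>i\<in>V. form n k (p i) (u i) = 0)"

definition trivial_motion ::
  "nat \<Rightarrow> nat \<Rightarrow> real vec set \<Rightarrow> (real vec \<Rightarrow> real vec) \<Rightarrow> bool" where
  "trivial_motion n k X w \<longleftrightarrow>
     w \<in> X \<rightarrow> carrier_vec (n + 1) \<and>
     (\<forall>x\<in>X. \<forall>y\<in>X. form n k x (w y) + form n k y (w x) = 0) \<and>
     (\<forall>z\<in>X. form n k z (w z) = 0)"

definition first_order_rigid ::
  "nat \<Rightarrow> nat \<Rightarrow> real vec set \<Rightarrow> 'v set \<Rightarrow> 'v set set \<Rightarrow> ('v \<Rightarrow> real vec) \<Rightarrow> bool" where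
  "first_order_rigid n k X V E p \<longleftrightarrow>
     (\<forall>u. first_order_motion n k V E p u \<longrightarrow>
        (\<exists>w. trivial_motion n k X w \<and> (\<forall>i\<in>V. u i = w (p i))))"

definition psi :: "real vec \<Rightarrow> real vec" where
  "psi x = (1 / sqrt (x \<bullet> x)) \<cdot>\<^sub>v x"

lemma form_0:
  assumes "x \<in> carrier_vec (n + 1)" "y \<in> carrier_vec (n + 1)"
  shows "form n 0 x y = x \<bullet> y"
  using assms by (simp add: form_def scalar_prod_def)

lemma quadric_0_1: "quadric n 0 1 = hemisphere n"
  using form_0 by (auto simp: quadric_def hemisphere_def)

lemma psi_in_hemisphere:
  assumes "x \<in> quadric n k c"
  shows "psi x \<in> hemisphere n"
proof -
  have x: "x \<in> carrier_vec (n + 1)" and pos: "x $ n > 0"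
    using assms by (auto simp: quadric_def)
  have "0 < x $ n * x $ n" using pos by simp
  also have "\<dots> \<le> x \<bullet> x"
    using x unfolding scalar_prod_def
    by (intro member_le_sum[where f = "\<lambda>i. x $ i * x $ i"]) auto
  finally have "x \<bullet> x > 0" .
  then show ?thesis
    using x pos by (simp add: hemisphere_def psi_def)
qed

end

theory Submission
  imports Defs
begin

text \<open>
  Let \<open>J\<close> be the diagonal sign matrix with \<open>\<langle>x, y\<rangle>\<^sub>k = x \<bullet> J y\<close>; below it is
  called \<open>flip\<close>. Write \<open>\<parallel>x\<parallel>\<close> for \<open>sqrt (x \<bullet> x)\<close>. Since
  \<open>(p\<^sub>i / \<parallel>p\<^sub>i\<parallel>) \<bullet> (J u\<^sub>j / \<parallel>p\<^sub>j\<parallel>)\<close> is \<open>\<langle>p\<^sub>i, u\<^sub>j\<rangle>\<^sub>k\<close> divided by a factor symmetric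
  in \<open>i\<close> and \<open>j\<close>, the substitution \<open>u\<^sub>i \<mapsto> J u\<^sub>i / \<parallel>p\<^sub>i\<parallel>\<close> is a bijection between the first-order
  motions of the framework in the quadric and those of its projection to the hemisphere
  (\<open>first_order_motion_transfer\<close>). It remains to see that this bijection respects triviality.

  A trivial motion \<open>w\<close> of the hemisphere pulls back to \<open>x \<mapsto> \<parallel>x\<parallel> J (w (x / \<parallel>x\<parallel>))\<close>, which is
  trivial on the quadric by the same computation (\<open>trivial_motion_pullback\<close>). The converse has real
  content, because the projection of the quadric is in general only part of the hemisphere, so a
  trivial motion has to be extended. For this one shows that a trivial motion \<open>w\<close> of a nonempty
  quadric has the form \<open>w x = J A x\<close> with a skew-symmetric matrix \<open>A\<close>; then \<open>y \<mapsto> A y\<close> is a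
  trivial motion of the whole hemisphere (\<open>trivial_motion_quadric_extends\<close>). Linearity comes
  from duality: the relation \<open>x \<bullet> J w(y) = - y \<bullet> J w(x)\<close> makes \<open>x \<bullet> J w(y)\<close> linear in \<open>y\<close> for each
  \<open>x\<close> in the quadric, and the quadric spans the space (\<open>skew_on_spanning_set_is_linear\<close>). It spans
  because the cone over it is open: this is where \<open>c \<noteq> 0\<close> enters
  (\<open>unit_vec_combination_of_quadric\<close>).
\<close>

section \<open>The form as a twisted dot product\<close>

definition flip :: "nat \<Rightarrow> nat \<Rightarrow> real vec \<Rightarrow> real vec" where
  "flip n k x = vec (n + 1) (\<lambda>i. if i < n + 1 - k then x $ i else - x $ i)"

lemma flip_carrier [simplified, simp]: "flip n k x \<in> carrier_vec (n + 1)"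
  by (simp add: flip_def)

lemma flip_flip [simp]: "x \<in> carrier_vec (n + 1) \<Longrightarrow> flip n k (flip n k x) = x"
  by (auto simp: flip_def)

lemma flip_smult: "x \<in> carrier_vec (n + 1) \<Longrightarrow> flip n k (a \<cdot>\<^sub>v x) = a \<cdot>\<^sub>v flip n k x"
  by (auto simp: flip_def)

lemma form_eq_scalar_prod_flip: "form n k x y = x \<bullet> flip n k y"
proof -
  let ?g = "\<lambda>i. x $ i * flip n k y $ i"
  have "x \<bullet> flip n k y = sum ?g {0..<n + 1}"
    by (simp add: scalar_prod_def flip_def)
  also have "\<dots> = sum ?g {0..<n + 1 - k} + sum ?g {n + 1 - k..<n + 1}"
    by (rule sum.atLeastLessThan_concat[symmetric]) auto
  also have "sum ?g {0..<n + 1 - k} = (\<Sum>i\<in>{0..<n + 1 - k}. x $ i * y $ i)"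
    by (rule sum.cong) (auto simp: flip_def)
  also have "sum ?g {n + 1 - k..<n + 1} = - (\<Sum>i\<in>{n + 1 - k..<n + 1}. x $ i * y $ i)"
    unfolding sum_negf[symmetric] by (rule sum.cong) (auto simp: flip_def)
  finally show ?thesis
    by (simp add: form_def)
qed

lemma form_smult_smult:
  assumes "x \<in> carrier_vec (n + 1)" "y \<in> carrier_vec (n + 1)"
  shows "form n k (a \<cdot>\<^sub>v x) (b \<cdot>\<^sub>v y) = a * b * form n k x y"
  using assms
  by (simp add: form_eq_scalar_prod_flip flip_smult
      smult_scalar_prod_distrib[of _ "Suc n"] scalar_prod_smult_distrib[of _ "Suc n"])

lemma form_flip_right:
  assumes "x \<in> carrier_vec (n + 1)" "y \<in> carrier_vec (n + 1)"
  shows "form n k x (flip n k y) = form n 0 x y"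
  using assms by (simp add: form_0[simplified] form_eq_scalar_prod_flip[of n k])

lemma form_0_flip_right:
  assumes "x \<in> carrier_vec (n + 1)"
  shows "form n 0 x (flip n k y) = form n k x y"
  using assms by (simp add: form_0[simplified] form_eq_scalar_prod_flip[of n k])

section \<open>Trivial motions are skew-symmetric linear maps\<close>

text \<open>
  Skewness determines \<open>w z\<close> by its products with elements of \<open>X\<close>, and \<open>x \<bullet> w z = - (z \<bullet> w x)\<close> is
  linear in \<open>z\<close>. Writing the unit vectors in terms of \<open>X\<close> thus makes every coordinate of \<open>w z\<close>
  linear in \<open>z\<close>. Two elements of \<open>X\<close> for each unit vector are what a perturbation argument provides,
  and allowing different pairs for different unit vectors avoids choosing a basis inside \<open>X\<close>.
\<close>

lemma skew_on_spanning_set_is_linear: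
  fixes w :: "real vec \<Rightarrow> real vec"
  assumes X: "X \<subseteq> carrier_vec N" and w: "w \<in> X \<rightarrow> carrier_vec N"
    and skew: "\<And>x y. x \<in> X \<Longrightarrow> y \<in> X \<Longrightarrow> x \<bullet> w y + y \<bullet> w x = 0"
    and span: "\<And>i. i < N \<Longrightarrow> \<exists>x\<in>X. \<exists>y\<in>X. \<exists>a b. unit_vec N i = a \<cdot>\<^sub>v x + b \<cdot>\<^sub>v y"
  obtains A where "A \<in> carrier_mat N N" "transpose_mat A = - A" "\<And>x. x \<in> X \<Longrightarrow> w x = A *\<^sub>v x"
proof -
  have "\<forall>i. \<exists>x y a b. i < N \<longrightarrow> x \<in> X \<and> y \<in> X \<and> unit_vec N i = a \<cdot>\<^sub>v x + b \<cdot>\<^sub>v y"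
    using span by blast
  then obtain x y a b where comb:
    "\<And>i. i < N \<Longrightarrow> x i \<in> X \<and> y i \<in> X \<and> unit_vec N i = a i \<cdot>\<^sub>v x i + b i \<cdot>\<^sub>v y i"
    by metis
  \<comment> \<open>The value at the \<open>i\<close>-th unit vector of the linear map to be constructed.\<close>
  define f where "f i = a i \<cdot>\<^sub>v w (x i) + b i \<cdot>\<^sub>v w (y i)" for i
  have wc: "w z \<in> carrier_vec N" and zc: "z \<in> carrier_vec N" if "z \<in> X" for z
    using that w X by auto
  have fc: "f i \<in> carrier_vec N" if "i < N" for i
    using comb[OF that] wc by (simp add: f_def)
  have coord: "w z $ i = - (z \<bullet> f i)" if z: "z \<in> X" and i: "i < N" for z i
  proof -
    note c = comb[OF i]
    have "w z $ i = unit_vec N i \<bullet> w z"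
      using wc[OF z] i by simp
    also have "\<dots> = a i * (x i \<bullet> w z) + b i * (y i \<bullet> w z)"
      using c zc wc z
      by (simp add: add_scalar_prod_distrib[of _ N] smult_scalar_prod_distrib[of _ N])
    also have "\<dots> = - (a i * (z \<bullet> w (x i)) + b i * (z \<bullet> w (y i)))"
      using skew[of "x i" z] skew[of "y i" z] c z
      by (simp add: add_eq_0_iff)
    also have "\<dots> = - (z \<bullet> f i)"
      using c zc wc z by (simp add: f_def scalar_prod_add_distrib[of _ N] scalar_prod_smult_distrib[of _ N])
    finally show ?thesis .
  qed
  have f_skew: "f j $ i = - f i $ j" if i: "i < N" and j: "j < N" for i j
  proof -
    note c = comb[OF j]
    have "f j $ i = a j * w (x j) $ i + b j * w (y j) $ i"
      using wc[of "x j"] wc[of "y j"] c i by (simp add: f_def)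
    also have "\<dots> = - (a j * (x j \<bullet> f i) + b j * (y j \<bullet> f i))"
      using coord c i by simp
    also have "\<dots> = - (unit_vec N j \<bullet> f i)"
      using c zc fc i
      by (simp add: add_scalar_prod_distrib[of _ N] smult_scalar_prod_distrib[of _ N])
    also have "\<dots> = - f i $ j"
      using fc i j by simp
    finally show ?thesis .
  qed
  define A where "A = mat N N (\<lambda>(i, j). f j $ i)"
  show thesis
  proof
    show "A \<in> carrier_mat N N"
      by (simp add: A_def)
    show "transpose_mat A = - A"
    proof (rule eq_matI)
      fix i j assume "i < dim_row (- A)" "j < dim_col (- A)"
      then have "i < N" "j < N" by (simp_all add: A_def)
      then show "transpose_mat A $$ (i, j) = (- A) $$ (i, j)"
        using f_skew[of j i] by (simp add: A_def)
    qed (simp_all add: A_def)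
    show "w z = A *\<^sub>v z" if z: "z \<in> X" for z
    proof (rule eq_vecI)
      fix i assume "i < dim_vec (A *\<^sub>v z)"
      then have i: "i < N" by (simp add: A_def)
      have "w z $ i = (\<Sum>j\<in>{0..<N}. - (z $ j * f i $ j))"
        using coord[OF z i] fc[OF i] by (simp add: scalar_prod_def sum_negf carrier_vecD)
      also have "\<dots> = (\<Sum>j\<in>{0..<N}. f j $ i * z $ j)"
        using i by (intro sum.cong) (auto simp: f_skew[OF i])
      also have "\<dots> = (A *\<^sub>v z) $ i"
        using i zc[OF z] by (auto simp: A_def scalar_prod_def carrier_vecD intro!: sum.cong)
      finally show "w z $ i = (A *\<^sub>v z) $ i" .
    qed (use wc[OF z] in \<open>auto simp: A_def\<close>)
  qed
qed

lemma skew_matrix_scalar_prod: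
  fixes A :: "real mat"
  assumes A: "A \<in> carrier_mat N N" and skew: "transpose_mat A = - A"
    and x: "x \<in> carrier_vec N" and y: "y \<in> carrier_vec N"
  shows "x \<bullet> (A *\<^sub>v y) + y \<bullet> (A *\<^sub>v x) = 0"
proof -
  have "x \<bullet> (A *\<^sub>v y) = (transpose_mat A *\<^sub>v x) \<bullet> y"
    by (rule transpose_vec_mult_scalar[symmetric, OF A y x])
  also have "\<dots> = - ((A *\<^sub>v x) \<bullet> y)"
    using A x y by (simp add: skew)
  also have "(A *\<^sub>v x) \<bullet> y = y \<bullet> (A *\<^sub>v x)"
    using A x y by (intro comm_scalar_prod[of _ N]) auto
  finally show ?thesis by simp
qed

text \<open>
  Moving \<open>x\<close> a little along a coordinate axis keeps the last coordinate positive and, as \<open>c \<noteq> 0\<close>,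
  keeps the sign of the form; rescaling then leads back to the quadric. The coordinate direction
  is the difference of the moved and the original point, divided by the step.
\<close>

lemma unit_vec_combination_of_quadric:
  assumes c: "c \<noteq> 0" and x: "x \<in> quadric n k c" and i: "i < n + 1"
  shows "\<exists>x\<in>quadric n k c. \<exists>y\<in>quadric n k c. \<exists>a b. unit_vec (n + 1) i = a \<cdot>\<^sub>v x + b \<cdot>\<^sub>v y"
proof -
  let ?z = "\<lambda>t. x + t \<cdot>\<^sub>v unit_vec (n + 1) i"
  let ?q = "\<lambda>t. form n k (?z t) (?z t)"
  have xc: "x \<in> carrier_vec (n + 1)" and xq: "form n k x x = c" and xn: "x $ n > 0"
    using x by (auto simp: quadric_def)
  have "((\<lambda>t. ?q t / c) \<longlongrightarrow> ?q 0 / c) (at_right 0)"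
  proof (intro tendsto_divide tendsto_const c)
    have coord: "?z t $ j = x $ j + t * (if j = i then 1 else 0)" if "j < n + 1" for t j
      using that xc by (simp add: unit_vec_def)
    have "?q = (\<lambda>t. (\<Sum>j\<in>{0..<n + 1 - k}. (x $ j + t * (if j = i then 1 else 0))^2)
        - (\<Sum>j\<in>{n + 1 - k..<n + 1}. (x $ j + t * (if j = i then 1 else 0))^2))"
      unfolding form_def power2_eq_square
      by (intro ext arg_cong2[where f = "(-)"] sum.cong) (auto simp only: coord atLeastLessThan_iff)
    then have "isCont ?q 0"
      by (simp only:) (intro continuous_intros)
    then show "(?q \<longlongrightarrow> ?q 0) (at_right 0)"
      by (simp add: isCont_def filterlim_at_split)
  qed
  moreover have "?q 0 / c > 0"
  proof -
    have "?z 0 = x"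
      using xc by (intro eq_vecI) auto
    then show ?thesis
      using c by (simp only: xq) simp
  qed
  ultimately have "eventually (\<lambda>t. ?q t / c > 0) (at_right 0)"
    by (rule order_tendstoD)
  then have "eventually (\<lambda>t. ?q t / c > 0 \<and> t > 0) (at_right 0)"
    using eventually_at_right_less by (rule eventually_conj)
  then obtain t where t: "?q t / c > 0" "t > 0"
    using eventually_happens trivial_limit_at_right_real by blast
  \<comment> \<open>The scaling factor that brings the moved point back to the level \<open>c\<close>.\<close>
  define s where "s = sqrt (c / ?q t)"
  have pos: "c / ?q t > 0"
    using t(1) by (auto simp: zero_less_divide_iff)
  have s: "s > 0"
    using pos unfolding s_def by (rule real_sqrt_gt_zero)
  have "s * s = c / ?q t"
    using pos unfolding s_def real_sqrt_mult_self by (rule abs_of_pos)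
  then have sq: "s * s * ?q t = c"
    using t(1) by auto
  have "s \<cdot>\<^sub>v ?z t \<in> quadric n k c"
    using s sq t(2) xc xn i by (auto simp: quadric_def form_smult_smult intro!: mult_pos_pos add_pos_nonneg)
  moreover have "unit_vec (n + 1) i = (- 1 / t) \<cdot>\<^sub>v x + (1 / (s * t)) \<cdot>\<^sub>v (s \<cdot>\<^sub>v ?z t)"
    using s t(2) xc by (intro eq_vecI) (auto simp: field_simps)
  ultimately show ?thesis
    using x by blast
qed

text \<open>
  A single matrix describes the motion on the quadric and extends it to the hemisphere; linearity
  is what later allows the norm of a point to be divided out.
\<close>

lemma trivial_motion_quadric_extends:
  assumes c: "c \<noteq> 0" and w: "trivial_motion n k (quadric n k c) w"
  obtains A where "A \<in> carrier_mat (n + 1) (n + 1)" "trivial_motion n 0 (hemisphere n) (\<lambda>y. A *\<^sub>v y)"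
    "\<And>x. x \<in> quadric n k c \<Longrightarrow> flip n k (w x) = A *\<^sub>v x"
proof (cases "quadric n k c = {}")
  \<comment> \<open>An empty quadric does not span, for example if \<open>k = 0\<close> and \<open>c < 0\<close>; then any skew matrix works.\<close>
  case True
  have "0\<^sub>m (n + 1) (n + 1) *\<^sub>v y = 0\<^sub>v (n + 1)" if "y \<in> carrier_vec (n + 1)" for y :: "real vec"
    using that by (intro eq_vecI) auto
  then have "trivial_motion n 0 (hemisphere n) (\<lambda>y. 0\<^sub>m (n + 1) (n + 1) *\<^sub>v y)"
    by (auto simp: trivial_motion_def hemisphere_def form_0[simplified])
  then show thesis
    using True by (intro that[of "0\<^sub>m (n + 1) (n + 1)"]) auto
next
  case False
  then obtain x0 where "x0 \<in> quadric n k c" by blast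
  note span = unit_vec_combination_of_quadric[OF c this]
  obtain A where A: "A \<in> carrier_mat (n + 1) (n + 1)" "transpose_mat A = - A"
    "\<And>x. x \<in> quadric n k c \<Longrightarrow> flip n k (w x) = A *\<^sub>v x"
  proof (rule skew_on_spanning_set_is_linear[of "quadric n k c" "n + 1" "\<lambda>x. flip n k (w x)"])
    show "x \<bullet> flip n k (w y) + y \<bullet> flip n k (w x) = 0"
      if "x \<in> quadric n k c" "y \<in> quadric n k c" for x y
      using w that by (simp add: trivial_motion_def form_eq_scalar_prod_flip)
  qed (use span in \<open>auto simp: quadric_def\<close>)
  have "trivial_motion n 0 (hemisphere n) (\<lambda>y. A *\<^sub>v y)"
    using A(1) skew_matrix_scalar_prod[OF A(1,2)]
    by (force simp: trivial_motion_def hemisphere_def form_0)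
  then show thesis
    using A that by blast
qed

section \<open>Transfer along the central projection\<close>

lemma quadric_scalar_prod_pos:
  assumes "x \<in> quadric n k c"
  shows "x \<bullet> x > 0"
  using psi_in_hemisphere[OF assms] assms
  by (auto simp: hemisphere_def psi_def quadric_def)

text \<open>
  The factors \<open>r i\<close> and \<open>r j\<close> occur in both summands of the condition on an edge, once through the
  point and once through the velocity, and so cancel. Points and velocities must therefore be
  rescaled by the same factor.
\<close>

lemma first_order_motion_transfer:
  assumes "finite_graph V E"
    and p: "p \<in> V \<rightarrow> carrier_vec (n + 1)" and u: "u \<in> V \<rightarrow> carrier_vec (n + 1)"
    and r: "\<And>i. i \<in> V \<Longrightarrow> r i \<noteq> 0"
    and q: "\<And>i. i \<in> V \<Longrightarrow> q i = r i \<cdot>\<^sub>v p i" and v: "\<And>i. i \<in> V \<Longrightarrow> v i = r i \<cdot>\<^sub>v flip n k (u i)"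
  shows "first_order_motion n 0 V E q v \<longleftrightarrow> first_order_motion n k V E p u"
proof -
  have in_V: "i \<in> V" "j \<in> V" if "{i, j} \<in> E" for i j
    using assms(1) that by (auto simp: finite_graph_def)
  have eq: "form n 0 (q i) (v j) = r i * r j * form n k (p i) (u j)" if "i \<in> V" "j \<in> V" for i j
    using that p q v by (auto simp: form_smult_smult form_0_flip_right Pi_iff)
  have "form n 0 (q i) (v j) + form n 0 (q j) (v i) = 0 \<longleftrightarrow>
      form n k (p i) (u j) + form n k (p j) (u i) = 0" if "i \<in> V" "j \<in> V" for i j
  proof -
    have "form n 0 (q i) (v j) + form n 0 (q j) (v i)
        = r i * r j * (form n k (p i) (u j) + form n k (p j) (u i))"
      using that by (simp add: eq algebra_simps)
    then show ?thesis using r that by simp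
  qed
  moreover have "form n 0 (q i) (v i) = 0 \<longleftrightarrow> form n k (p i) (u i) = 0" if "i \<in> V" for i
    using that r by (simp add: eq)
  moreover have "v \<in> V \<rightarrow> carrier_vec (n + 1)"
    using v by auto
  ultimately show ?thesis
    using u in_V unfolding first_order_motion_def by blast
qed

text \<open>
  The same cancellation for motions of the whole space; here the velocity is multiplied by the norm,
  since the passage goes from the normalised point back to the original one.
\<close>

lemma trivial_motion_pullback:
  assumes w: "trivial_motion n 0 (hemisphere n) w"
  shows "trivial_motion n k (quadric n k c) (\<lambda>x. sqrt (x \<bullet> x) \<cdot>\<^sub>v flip n k (w (psi x)))"
proof -
  let ?X = "quadric n k c" and ?w = "\<lambda>x. sqrt (x \<bullet> x) \<cdot>\<^sub>v flip n k (w (psi x))"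
  have eq: "form n k x (?w y) = sqrt (x \<bullet> x) * sqrt (y \<bullet> y) * form n 0 (psi x) (w (psi y))"
    if x: "x \<in> ?X" and y: "y \<in> ?X" for x y
  proof -
    have wc: "w (psi y) \<in> carrier_vec (n + 1)"
      using w psi_in_hemisphere[OF y] by (auto simp: trivial_motion_def)
    have xc: "x \<in> carrier_vec (n + 1)" and pc: "psi x \<in> carrier_vec (n + 1)"
      using x by (auto simp: quadric_def psi_def)
    have "x = sqrt (x \<bullet> x) \<cdot>\<^sub>v psi x"
      using quadric_scalar_prod_pos[OF x] by (simp add: psi_def smult_smult_assoc)
    then have "form n k x (?w y) = form n k (sqrt (x \<bullet> x) \<cdot>\<^sub>v psi x) (?w y)"
      by simp
    also have "\<dots> = sqrt (x \<bullet> x) * sqrt (y \<bullet> y) * form n k (psi x) (flip n k (w (psi y)))"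
      using pc by (rule form_smult_smult) simp
    finally show ?thesis
      using pc wc by (simp add: form_flip_right)
  qed
  have "form n k x (?w y) + form n k y (?w x) = 0" if "x \<in> ?X" "y \<in> ?X" for x y
  proof -
    have "form n 0 (psi x) (w (psi y)) + form n 0 (psi y) (w (psi x)) = 0"
      using w psi_in_hemisphere that by (auto simp: trivial_motion_def)
    moreover have "form n k x (?w y) + form n k y (?w x) = sqrt (x \<bullet> x) * sqrt (y \<bullet> y) *
        (form n 0 (psi x) (w (psi y)) + form n 0 (psi y) (w (psi x)))"
      using that by (simp only: eq) (simp add: algebra_simps)
    ultimately show ?thesis by simp
  qed
  moreover have "form n k z (?w z) = 0" if "z \<in> ?X" for z
    using w psi_in_hemisphere[OF that] that by (simp only: eq) (simp add: trivial_motion_def)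
  ultimately show ?thesis
    by (auto simp: trivial_motion_def)
qed

theorem theorem5p6:
  fixes n k :: nat and c :: real
    and V :: "'v set" and E :: "'v set set" and p :: "'v \<Rightarrow> real vec"
  assumes "n \<ge> 1" and "k \<le> n + 1" and "c \<noteq> 0"
    and "finite_graph V E"
    and "p \<in> V \<rightarrow> quadric n k c"
  shows "first_order_rigid n k (quadric n k c) V E p \<longleftrightarrow>
         first_order_rigid n 0 (hemisphere n) V E (psi \<circ> p)"
proof -
  define r where "r i = sqrt (p i \<bullet> p i)" for i
  have pX: "p i \<in> quadric n k c" and pc: "p i \<in> carrier_vec (n + 1)" and r: "r i > 0" if "i \<in> V" for i
    using assms(5) that quadric_scalar_prod_pos by (auto simp: r_def quadric_def)
  have motion_iff: "first_order_motion n 0 V E (psi \<circ> p) v \<longleftrightarrow> first_order_motion n k V E p u"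
    if "u \<in> V \<rightarrow> carrier_vec (n + 1)" and "\<And>i. i \<in> V \<Longrightarrow> v i = (1 / r i) \<cdot>\<^sub>v flip n k (u i)" for u v
  proof (rule first_order_motion_transfer[where r = "\<lambda>i. 1 / r i"])
    show "1 / r i \<noteq> 0" if "i \<in> V" for i
      using r[OF that] by simp
  qed (use assms(4) pc that in \<open>auto simp: psi_def r_def\<close>)
  show ?thesis
  proof
    assume rigid: "first_order_rigid n k (quadric n k c) V E p"
    show "first_order_rigid n 0 (hemisphere n) V E (psi \<circ> p)"
      unfolding first_order_rigid_def
    proof (intro allI impI)
      fix v assume v: "first_order_motion n 0 V E (psi \<circ> p) v"
      define u where "u i = r i \<cdot>\<^sub>v flip n k (v i)" for i
      have vu: "v i = (1 / r i) \<cdot>\<^sub>v flip n k (u i)" if "i \<in> V" for i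
      proof -
        have "v i \<in> carrier_vec (n + 1)"
          using v that by (auto simp: first_order_motion_def)
        then show ?thesis
          using r[OF that] by (simp add: u_def flip_smult smult_smult_assoc)
      qed
      have "u \<in> V \<rightarrow> carrier_vec (n + 1)"
        by (simp add: u_def)
      then have "first_order_motion n k V E p u"
        using v motion_iff[OF _ vu] by blast
      then obtain w where w: "trivial_motion n k (quadric n k c) w" "\<And>i. i \<in> V \<Longrightarrow> u i = w (p i)"
        using rigid by (auto simp: first_order_rigid_def)
      obtain A where A: "A \<in> carrier_mat (n + 1) (n + 1)"
        "trivial_motion n 0 (hemisphere n) (\<lambda>y. A *\<^sub>v y)"
        "\<And>x. x \<in> quadric n k c \<Longrightarrow> flip n k (w x) = A *\<^sub>v x"
        using trivial_motion_quadric_extends[OF assms(3) w(1)] by blast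
      have "v i = A *\<^sub>v (psi \<circ> p) i" if "i \<in> V" for i
        using vu[OF that] w(2)[OF that] A(3)[OF pX[OF that]] A(1) pc[OF that]
        by (simp add: psi_def r_def mult_mat_vec)
      then show "\<exists>w. trivial_motion n 0 (hemisphere n) w \<and> (\<forall>i\<in>V. v i = w ((psi \<circ> p) i))"
        using A(2) by blast
    qed
  next
    assume rigid: "first_order_rigid n 0 (hemisphere n) V E (psi \<circ> p)"
    show "first_order_rigid n k (quadric n k c) V E p"
      unfolding first_order_rigid_def
    proof (intro allI impI)
      fix u assume u: "first_order_motion n k V E p u"
      have uc: "u \<in> V \<rightarrow> carrier_vec (n + 1)"
        using u by (simp add: first_order_motion_def)
      define v where "v i = (1 / r i) \<cdot>\<^sub>v flip n k (u i)" for i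
      have "first_order_motion n 0 V E (psi \<circ> p) v"
        using u motion_iff[OF uc] by (simp add: v_def)
      then obtain w where w: "trivial_motion n 0 (hemisphere n) w"
        "\<And>i. i \<in> V \<Longrightarrow> v i = w (psi (p i))"
        using rigid by (auto simp: first_order_rigid_def)
      have "u i = sqrt (p i \<bullet> p i) \<cdot>\<^sub>v flip n k (w (psi (p i)))" if "i \<in> V" for i
      proof -
        have "u i \<in> carrier_vec (n + 1)" using uc that by blast
        then show ?thesis
          using r[OF that] unfolding w(2)[OF that, symmetric] r_def[symmetric]
          by (simp add: v_def flip_smult smult_smult_assoc)
      qed
      then show "\<exists>w. trivial_motion n k (quadric n k c) w \<and> (\<forall>i\<in>V. u i = w (p i))"
        using trivial_motion_pullback[OF w(1)] by blast
    qed
  qed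
qed

end
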